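(* Let $T:\Delta\to\Delta$ be an endofunctor of the simplex category such that $T([0])=[n]$. Then $T$ is a sum of $n+1$ of the basis functors; that is, there exist $B_0,\dots,B_n\in\{Id, C_0, Op\}$ (repetitions allowed) such that $T=B_0+B_1+\cdots+B_n$.
   Context: The simplex category $\Delta$ has as objects the totally ordered nonempty finite sets and as morphisms the order preserving (i.e. weakly monotone) maps. Since every object is uniquely isomorphic to exactly one $[n]=\{0,1,\dots,n\}$, $n\ge 0$, the objects are taken to be the sets $[n]$. Basis endofunctors $\Delta\to\Delta$: $Id$ is the identity functor; $C_0$ is the constant functor sending every object to $[0]$ and every morphism to $\mathrm{id}_{[0]}$; $Op$ is the identity on objects and sends $f:[n]\to[m]$ to the morphism $Op(f):[n]\to[m]$, $Op(f)(k)=m-f(n-k)$. The concatenation bifunctor $*:\Delta\times\Delta\to\Delta$ is given on objects by $[n]*[m]=[n+m+1]$, and for $f:[n_1]\to[n_2]$, $g:[m_1]\to[m_2]$ the map $f*g:[n_1+m_1+1]\to[n_2+m_2+1]$ is $(f*g)(k)=f(k)$ for $0\le k\le n_1$ and $(f*g)(k)=n_2+1+g(k-n_1-1)$ for $n_1<k\le n_1+m_1+1$. For endofunctors $T_1,T_2$ of $\Delta$, the sum $T_1+T_2$ is the composite $\Delta\xrightarrow{(T_1,T_2)}\Delta\times\Delta\xrightarrow{*}\Delta$. This operation is associative. A "sum" of one functor is that functor itself. *)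

theory Defs
  imports "HOL-Library.FuncSet"
begin

(* The object [n] = {0,...,n} of the simplex category is represented by the number n.  A morphism
   carries its source and target; its underlying function is extensional (undefined outside
   {..n}), so that equality of morphisms is the HOL equality. *)
typedef smor =
  "{(n :: nat, m :: nat, f :: nat \<Rightarrow> nat). f \<in> {..n} \<rightarrow>\<^sub>E {..m} \<and> mono_on {..n} f}"
  by (rule exI[of _ "(0, 0, \<lambda>k\<in>{..0}. 0)"]) (auto simp: mono_on_def)

definition source :: "smor \<Rightarrow> nat" where
  "source f = fst (Rep_smor f)"

definition target :: "smor \<Rightarrow> nat" where
  "target f = fst (snd (Rep_smor f))"

definition app :: "smor \<Rightarrow> nat \<Rightarrow> nat" where
  "app f = snd (snd (Rep_smor f))"

(* The morphism [n] \<rightarrow> [m] given by k \<mapsto> f k; only meaningful if f is weakly monotone on {..n} with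
   values in {..m}. *)
definition mor :: "nat \<Rightarrow> nat \<Rightarrow> (nat \<Rightarrow> nat) \<Rightarrow> smor" where
  "mor n m f = Abs_smor (n, m, restrict f {..n})"

definition ident :: "nat \<Rightarrow> smor" where
  "ident n = mor n n (\<lambda>k. k)"

(* Only meaningful if target f = source g. *)
definition comp :: "smor \<Rightarrow> smor \<Rightarrow> smor"  (infixl \<open>\<circ>\<^sub>\<Delta>\<close> 55) where
  "g \<circ>\<^sub>\<Delta> f = mor (source f) (target g) (\<lambda>k. app g (app f k))"

record functor_data =
  obj :: "nat \<Rightarrow> nat"
  arr :: "smor \<Rightarrow> smor"

definition endofunctor :: "functor_data \<Rightarrow> bool" where
  "endofunctor T \<longleftrightarrow>
     (\<forall>f. source (arr T f) = obj T (source f) \<and> target (arr T f) = obj T (target f)) \<and>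
     (\<forall>n. arr T (ident n) = ident (obj T n)) \<and>
     (\<forall>f g. target f = source g \<longrightarrow> arr T (g \<circ>\<^sub>\<Delta> f) = arr T g \<circ>\<^sub>\<Delta> arr T f)"

definition Id_functor :: functor_data where
  "Id_functor = \<lparr>obj = (\<lambda>n. n), arr = (\<lambda>f. f)\<rparr>"

definition C0_functor :: functor_data where
  "C0_functor = \<lparr>obj = (\<lambda>_. 0), arr = (\<lambda>_. ident 0)\<rparr>"

definition op_mor :: "smor \<Rightarrow> smor" where
  "op_mor f = mor (source f) (target f) (\<lambda>k. target f - app f (source f - k))"

definition Op_functor :: functor_data where
  "Op_functor = \<lparr>obj = (\<lambda>n. n), arr = op_mor\<rparr>"

definition concat_obj :: "nat \<Rightarrow> nat \<Rightarrow> nat" where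
  "concat_obj n m = n + m + 1"

definition concat_mor :: "smor \<Rightarrow> smor \<Rightarrow> smor" where
  "concat_mor f g =
     mor (concat_obj (source f) (source g)) (concat_obj (target f) (target g))
       (\<lambda>k. if k \<le> source f then app f k else target f + 1 + app g (k - source f - 1))"

definition functor_add :: "functor_data \<Rightarrow> functor_data \<Rightarrow> functor_data"  (infixl \<open>\<oplus>\<^sub>\<Delta>\<close> 65) where
  "T \<oplus>\<^sub>\<Delta> S = \<lparr>obj = (\<lambda>n. concat_obj (obj T n) (obj S n)),
              arr = (\<lambda>f. concat_mor (arr T f) (arr S f))\<rparr>"

(* functor_sum B n = B 0 + ... + B n, with n + 1 summands, bracketed to the left; by
   functor_add_assoc below the bracketing is irrelevant. *)
primrec functor_sum :: "(nat \<Rightarrow> functor_data) \<Rightarrow> nat \<Rightarrow> functor_data" where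
  "functor_sum B 0 = B 0"
| "functor_sum B (Suc n) = functor_sum B n \<oplus>\<^sub>\<Delta> B (Suc n)"


lemma app_le: "k \<le> source f \<Longrightarrow> app f k \<le> target f"
  using Rep_smor[of f] by (auto simp: source_def target_def app_def split: prod.splits)

lemma app_mono: "j \<le> k \<Longrightarrow> k \<le> source f \<Longrightarrow> app f j \<le> app f k"
  using Rep_smor[of f] by (auto simp: source_def app_def mono_on_def split: prod.splits)

lemma smor_eqI:
  assumes "source f = source g" "target f = target g" "\<And>k. k \<le> source f \<Longrightarrow> app f k = app g k"
  shows "f = g"
proof -
  have "app f \<in> extensional {..source f}" "app g \<in> extensional {..source g}"
    using Rep_smor[of f] Rep_smor[of g]
    by (auto simp: source_def app_def PiE_def split: prod.splits)
  then have "app f = app g"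
    using assms by (auto intro: extensionalityI)
  with assms show ?thesis
    by (intro Rep_smor_inject[THEN iffD1]) (auto simp: source_def target_def app_def prod_eq_iff)
qed

lemma mor_props:
  assumes "\<And>k. k \<le> n \<Longrightarrow> f k \<le> m" "\<And>j k. j \<le> k \<Longrightarrow> k \<le> n \<Longrightarrow> f j \<le> f k"
  shows source_mor: "source (mor n m f) = n"
    and target_mor: "target (mor n m f) = m"
    and app_mor: "k \<le> n \<Longrightarrow> app (mor n m f) k = f k"
proof -
  have "Rep_smor (mor n m f) = (n, m, restrict f {..n})"
    unfolding mor_def using assms by (intro Abs_smor_inverse) (auto simp: mono_on_def)
  then show "source (mor n m f) = n" "target (mor n m f) = m"
    "k \<le> n \<Longrightarrow> app (mor n m f) k = f k"
    by (auto simp: source_def target_def app_def)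
qed

lemma ident_simps [simp]:
  "source (ident n) = n" "target (ident n) = n" "k \<le> n \<Longrightarrow> app (ident n) k = k"
  unfolding ident_def by (rule source_mor target_mor app_mor; simp)+

lemma comp_simps:
  assumes "target f = source g"
  shows source_comp: "source (g \<circ>\<^sub>\<Delta> f) = source f"
    and target_comp: "target (g \<circ>\<^sub>\<Delta> f) = target g"
    and app_comp: "k \<le> source f \<Longrightarrow> app (g \<circ>\<^sub>\<Delta> f) k = app g (app f k)"
proof -
  have le: "app g (app f k) \<le> target g" if "k \<le> source f" for k
    using app_le[OF that] assms by (simp add: app_le)
  have mono: "app g (app f j) \<le> app g (app f k)" if "j \<le> k" "k \<le> source f" for j k
    using app_le[OF that(2)] app_mono[OF that] assms by (simp add: app_mono)
  note props = mor_props[of "source f" "\<lambda>k. app g (app f k)" "target g", OF le mono]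
  show "source (g \<circ>\<^sub>\<Delta> f) = source f" "target (g \<circ>\<^sub>\<Delta> f) = target g"
    "k \<le> source f \<Longrightarrow> app (g \<circ>\<^sub>\<Delta> f) k = app g (app f k)"
    unfolding comp_def by (rule props; assumption)+
qed

lemma op_mor_simps:
  shows source_op_mor: "source (op_mor f) = source f"
    and target_op_mor: "target (op_mor f) = target f"
    and app_op_mor: "k \<le> source f \<Longrightarrow> app (op_mor f) k = target f - app f (source f - k)"
proof -
  have le: "target f - app f (source f - k) \<le> target f" for k
    by simp
  have mono: "target f - app f (source f - j) \<le> target f - app f (source f - k)"
    if "j \<le> k" "k \<le> source f" for j k
    using that by (intro diff_le_mono2 app_mono) auto
  note props = mor_props[of "source f" "\<lambda>k. target f - app f (source f - k)" "target f", OF le mono]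
  show "source (op_mor f) = source f" "target (op_mor f) = target f"
    "k \<le> source f \<Longrightarrow> app (op_mor f) k = target f - app f (source f - k)"
    unfolding op_mor_def by (rule props; assumption)+
qed

lemma concat_mor_simps:
  shows source_concat_mor: "source (concat_mor f g) = source f + source g + 1"
    and target_concat_mor: "target (concat_mor f g) = target f + target g + 1"
    and app_concat_mor: "k \<le> source f + source g + 1 \<Longrightarrow> app (concat_mor f g) k =
           (if k \<le> source f then app f k else target f + 1 + app g (k - source f - 1))"
proof -
  let ?h = "\<lambda>k. if k \<le> source f then app f k else target f + 1 + app g (k - source f - 1)"
  have le: "?h k \<le> target f + target g + 1" if "k \<le> source f + source g + 1" for k
    using app_le[of k f] app_le[of "k - source f - 1" g] that by auto
  have mono: "?h j \<le> ?h k" if "j \<le> k" "k \<le> source f + source g + 1" for j k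
    using that app_le[of j f] app_mono[of j k f]
      app_mono[of "j - source f - 1" "k - source f - 1" g] by auto
  note props = mor_props[of "source f + source g + 1" ?h "target f + target g + 1", OF le mono]
  show "source (concat_mor f g) = source f + source g + 1"
    "target (concat_mor f g) = target f + target g + 1"
    "k \<le> source f + source g + 1 \<Longrightarrow> app (concat_mor f g) k = ?h k"
    unfolding concat_mor_def concat_obj_def by (rule props; assumption)+
qed

lemma endofunctor_Id: "endofunctor Id_functor"
  by (simp add: endofunctor_def Id_functor_def)

lemma endofunctor_C0: "endofunctor C0_functor"
  by (auto simp: endofunctor_def C0_functor_def comp_simps intro!: smor_eqI)

lemma endofunctor_Op: "endofunctor Op_functor"
proof -
  have "op_mor (ident n) = ident n" for n
    by (rule smor_eqI) (simp_all add: op_mor_simps)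
  moreover have "op_mor (g \<circ>\<^sub>\<Delta> f) = op_mor g \<circ>\<^sub>\<Delta> op_mor f" if "target f = source g" for f g
    using that
    by (intro smor_eqI)
      (simp_all add: op_mor_simps comp_simps app_le flip: that)
  ultimately show ?thesis
    by (simp add: endofunctor_def Op_functor_def op_mor_simps)
qed

lemma endofunctor_add:
  assumes "endofunctor T" "endofunctor S"
  shows "endofunctor (T \<oplus>\<^sub>\<Delta> S)"
proof -
  have "concat_mor (ident n) (ident m) = ident (concat_obj n m)" for n m
    by (rule smor_eqI) (auto simp: concat_mor_simps concat_obj_def)
  moreover have "concat_mor (g \<circ>\<^sub>\<Delta> f) (g' \<circ>\<^sub>\<Delta> f') = concat_mor g g' \<circ>\<^sub>\<Delta> concat_mor f f'"
    if "target f = source g" "target f' = source g'" for f g f' g'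
  proof (rule smor_eqI)
    fix k assume "k \<le> source (concat_mor (g \<circ>\<^sub>\<Delta> f) (g' \<circ>\<^sub>\<Delta> f'))"
    then show "app (concat_mor (g \<circ>\<^sub>\<Delta> f) (g' \<circ>\<^sub>\<Delta> f')) k =
        app (concat_mor g g' \<circ>\<^sub>\<Delta> concat_mor f f') k"
      using that app_le[of k f] app_le[of "k - source f - 1" f']
      by (auto simp: concat_mor_simps comp_simps)
  qed (use that in \<open>simp_all add: concat_mor_simps comp_simps\<close>)
  ultimately show ?thesis
    using assms by (simp add: endofunctor_def functor_add_def concat_mor_simps concat_obj_def)
qed

lemma functor_add_assoc: "(T \<oplus>\<^sub>\<Delta> S) \<oplus>\<^sub>\<Delta> R = T \<oplus>\<^sub>\<Delta> (S \<oplus>\<^sub>\<Delta> R)"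
proof -
  have "concat_mor (concat_mor f g) h = concat_mor f (concat_mor g h)" for f g h
    by (rule smor_eqI) (auto simp: concat_mor_simps)
  then show ?thesis
    by (simp add: functor_add_def concat_obj_def fun_eq_iff)
qed

end

theory Submission
  imports Defs
begin

text \<open>
  The fibres of \<open>T[m] \<rightarrow> T[0] = [n]\<close> split \<open>T\<close> into \<open>n + 1\<close> functors that preserve \<open>[0]\<close>, so let
  \<open>T[0] = [0]\<close>; then every point \<open>i\<close> of \<open>[m]\<close> gives a point \<open>v\<^sub>i\<close> of \<open>T[m]\<close>. Up to composition with
  \<open>Op\<close> we have \<open>v\<^sub>0 \<le> v\<^sub>1\<close> in \<open>T[1]\<close>. Given \<open>y\<close> in \<open>T[m]\<close>, embed two copies of \<open>[m]\<close> into a larger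
  ordinal and compare the two resulting images of \<open>y\<close>, which is possible since the order is total;
  retracting onto one copy while collapsing the other to a point compares \<open>y\<close> with some \<open>v\<^sub>i\<close>.
  Adjacent copies yield \<open>v\<^sub>0 \<le> y \<le> v\<^sub>m\<close>, and one copy nested in the \<open>i\<close>-th gap of the other
  yields \<open>y \<le> v\<^sub>i\<close> or \<open>v\<^sub>i\<^sub>+\<^sub>1 \<le> y\<close>. Hence every element of \<open>T[m]\<close> is some \<open>v\<^sub>i\<close>, and \<open>T\<close> is \<open>C\<^sub>0\<close>
  or \<open>Id\<close> according to whether \<open>v\<^sub>0 = v\<^sub>1\<close> or \<open>v\<^sub>0 < v\<^sub>1\<close> in \<open>T[1]\<close>.
\<close>

section \<open>Morphisms given by monotone functions\<close>

definition monotone_map :: "nat \<Rightarrow> nat \<Rightarrow> (nat \<Rightarrow> nat) \<Rightarrow> bool" where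
  "monotone_map n m f \<longleftrightarrow> (\<forall>k\<le>n. f k \<le> m) \<and> (\<forall>j k. j \<le> k \<longrightarrow> k \<le> n \<longrightarrow> f j \<le> f k)"

lemma mor_simps [simp]:
  assumes "monotone_map n m f"
  shows "source (mor n m f) = n" "target (mor n m f) = m" "k \<le> n \<Longrightarrow> app (mor n m f) k = f k"
  using assms unfolding monotone_map_def by (intro source_mor target_mor app_mor; simp)+

lemma monotone_map_app: "monotone_map (source f) (target f) (app f)"
  by (simp add: monotone_map_def app_le app_mono)

lemma mor_app: "mor (source f) (target f) (app f) = f"
  by (rule smor_eqI) (simp_all add: monotone_map_app)

lemma comp_mor:
  assumes "monotone_map n m f" "monotone_map m l g" "\<And>k. k \<le> n \<Longrightarrow> h k = g (f k)"
  shows "mor m l g \<circ>\<^sub>\<Delta> mor n m f = mor n l h"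
proof -
  have "monotone_map n l h"
    using assms by (simp add: monotone_map_def)
  moreover have "f k \<le> m" if "k \<le> n" for k
    using assms(1) that by (simp add: monotone_map_def)
  ultimately show ?thesis
    using assms by (intro smor_eqI) (simp_all add: comp_simps)
qed

lemma op_mor_op_mor: "op_mor (op_mor f) = f"
  by (rule smor_eqI) (simp_all add: op_mor_simps app_le)

lemma op_mor_comp: "target f = source g \<Longrightarrow> op_mor (g \<circ>\<^sub>\<Delta> f) = op_mor g \<circ>\<^sub>\<Delta> op_mor f"
  using endofunctor_Op by (simp add: endofunctor_def Op_functor_def)

lemma op_mor_ident: "op_mor (ident n) = ident n"
  using endofunctor_Op by (simp add: endofunctor_def Op_functor_def)

section \<open>The action of an endofunctor on elements\<close>

locale simplex_endofunctor =
  fixes T :: functor_data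
  assumes endo: "endofunctor T"
begin

lemma source_arr [simp]: "source (arr T f) = obj T (source f)"
  and target_arr [simp]: "target (arr T f) = obj T (target f)"
  and arr_ident: "arr T (ident n) = ident (obj T n)"
  and arr_comp: "target f = source g \<Longrightarrow> arr T (g \<circ>\<^sub>\<Delta> f) = arr T g \<circ>\<^sub>\<Delta> arr T f"
  using endo by (simp_all add: endofunctor_def)

definition act :: "nat \<Rightarrow> nat \<Rightarrow> (nat \<Rightarrow> nat) \<Rightarrow> nat \<Rightarrow> nat" where
  "act n m f = app (arr T (mor n m f))"

lemma act_app: "app (arr T f) = act (source f) (target f) (app f)"
  by (simp add: act_def mor_app)

lemma act_le: "monotone_map n m f \<Longrightarrow> y \<le> obj T n \<Longrightarrow> act n m f y \<le> obj T m"
  unfolding act_def using app_le[of y "arr T (mor n m f)"] by simp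

lemma act_mono: "monotone_map n m f \<Longrightarrow> x \<le> y \<Longrightarrow> y \<le> obj T n \<Longrightarrow> act n m f x \<le> act n m f y"
  unfolding act_def using app_mono[of x y "arr T (mor n m f)"] by simp

text \<open>Functoriality for elements. The composite is any \<open>h\<close> agreeing with it on
  [n], so constants and identities can be recognised pointwise.\<close>

lemma act_act:
  assumes "monotone_map n m f" "monotone_map m l g" "\<And>k. k \<le> n \<Longrightarrow> h k = g (f k)" "y \<le> obj T n"
  shows "act m l g (act n m f y) = act n l h y"
proof -
  have "arr T (mor n l h) = arr T (mor m l g) \<circ>\<^sub>\<Delta> arr T (mor n m f)"
    using comp_mor[OF assms(1-3)] arr_comp assms(1,2) by (metis mor_simps(1,2))
  then show ?thesis
    unfolding act_def using assms by (simp add: app_comp)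
qed

lemma act_id: "(\<And>k. k \<le> n \<Longrightarrow> h k = k) \<Longrightarrow> y \<le> obj T n \<Longrightarrow> act n n h y = y"
proof -
  assume h: "\<And>k. k \<le> n \<Longrightarrow> h k = k" and y: "y \<le> obj T n"
  have "mor n n h = ident n"
    using h by (intro smor_eqI) (simp_all add: monotone_map_def)
  then show "act n n h y = y"
    using y by (simp add: act_def arr_ident)
qed

end

section \<open>Endofunctors fixing [0] and their vertices\<close>

locale pointed_endofunctor = simplex_endofunctor +
  assumes obj_0: "obj T 0 = 0"
begin

definition vertex :: "nat \<Rightarrow> nat \<Rightarrow> nat" where
  "vertex m i = act 0 m (\<lambda>_. i) 0"

lemma vertex_le: "i \<le> m \<Longrightarrow> vertex m i \<le> obj T m"
  unfolding vertex_def by (intro act_le) (auto simp: monotone_map_def)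

lemma act_vertex: "monotone_map m k f \<Longrightarrow> i \<le> m \<Longrightarrow> act m k f (vertex m i) = vertex k (f i)"
  unfolding vertex_def by (rule act_act) (auto simp: monotone_map_def)

text \<open>A constant map factors through [0], and T[0] = [0] has only one element.\<close>

lemma act_const:
  assumes "\<And>j. j \<le> m \<Longrightarrow> h j = i" "i \<le> k" "y \<le> obj T m"
  shows "act m k h y = vertex k i"
proof -
  have "act 0 k (\<lambda>_. i) (act m 0 (\<lambda>_. 0) y) = act m k h y"
    using assms by (intro act_act) (auto simp: monotone_map_def)
  moreover have "act m 0 (\<lambda>_. 0) y \<le> 0"
    using act_le[of m 0 "\<lambda>_. 0" y] assms obj_0 by (simp add: monotone_map_def)
  ultimately show ?thesis
    by (simp add: vertex_def)
qed

text \<open>Reduces comparing two vertices of T[m] to comparing those of T[1].\<close>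

lemma vertex_as_act:
  assumes "i \<le> j" "j \<le> m"
  shows "vertex m i = act 1 m (\<lambda>k. if k = 0 then i else j) (vertex 1 0)"
    "vertex m j = act 1 m (\<lambda>k. if k = 0 then i else j) (vertex 1 1)"
  using assms by (subst act_vertex; auto simp: monotone_map_def)+

end

section \<open>The order-preserving case: every element is a vertex\<close>

locale increasing_endofunctor = pointed_endofunctor +
  assumes vertex_01: "vertex 1 0 \<le> vertex 1 1"
begin

lemma vertex_mono: "i \<le> j \<Longrightarrow> j \<le> m \<Longrightarrow> vertex m i \<le> vertex m j"
  unfolding vertex_as_act[of i j m]
  by (intro act_mono vertex_01 vertex_le) (auto simp: monotone_map_def)

lemma vertex_bounds:
  assumes y: "y \<le> obj T m"
  shows "vertex m 0 \<le> y \<and> y \<le> vertex m m"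
proof -
  \<comment> \<open>The two copies of [m] in [2m] share the point m. The retraction
    \<open>min k m\<close> collapses the upper copy to m; the truncated \<open>k - m\<close>
    collapses the lower one to 0.\<close>
  have maps: "monotone_map m (2*m) (\<lambda>k. k)" "monotone_map m (2*m) (\<lambda>k. m + k)"
    "monotone_map (2*m) m (\<lambda>k. min k m)" "monotone_map (2*m) m (\<lambda>k. k - m)"
    by (auto simp: monotone_map_def)
  define a b where "a = act m (2*m) (\<lambda>k. k) y" and "b = act m (2*m) (\<lambda>k. m + k) y"
  have le: "a \<le> obj T (2*m)" "b \<le> obj T (2*m)"
    unfolding a_def b_def using maps y by (auto intro: act_le)
  have a: "act (2*m) m (\<lambda>k. min k m) a = y" "act (2*m) m (\<lambda>k. k - m) a = vertex m 0"
    unfolding a_def using maps y by (subst act_act[OF _ _ refl]; auto intro!: act_id act_const)+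
  have b: "act (2*m) m (\<lambda>k. min k m) b = vertex m m" "act (2*m) m (\<lambda>k. k - m) b = y"
    unfolding b_def using maps y by (subst act_act[OF _ _ refl]; auto intro!: act_id act_const)+
  show ?thesis
  proof (cases "a \<le> b")
    case True
    then show ?thesis
      using act_mono[OF maps(3) True] act_mono[OF maps(4) True] a b le by simp
  next
    case False
    then have "b \<le> a" by simp
    \<comment> \<open>The reversed comparison forces the first and the last vertex to coincide with
      y.\<close>
    then have "vertex m m \<le> y" "y \<le> vertex m 0"
      using act_mono[OF maps(3) \<open>b \<le> a\<close>] act_mono[OF maps(4) \<open>b \<le> a\<close>] a b le by simp_all
    then show ?thesis
      using vertex_mono[of 0 m m] by simp
  qed
qed

lemma vertex_gap:
  assumes y: "y \<le> obj T m" and i: "i < m"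
  shows "y \<le> vertex m i \<or> vertex m (Suc i) \<le> y"
proof -
  let ?N = "2*m + 1"
  \<comment> \<open>\<open>\<alpha>\<close> leaves m + 1 free places after i, which
    \<open>\<beta>\<close> fills. \<open>f j\<close> undoes \<open>\<alpha>\<close> and collapses
    these places to j; it stays monotone for j = i and j = i + 1.\<close>
  define \<alpha> \<beta> where "\<alpha> = (\<lambda>k. if k \<le> i then k else k + m + 1)" and "\<beta> = (\<lambda>k. i + 1 + k)"
  define f where "f j = (\<lambda>k. if k \<le> i then k else if k \<le> i + m + 1 then j else k - m - 1)" for j
  have maps: "monotone_map m ?N \<alpha>" "monotone_map m ?N \<beta>"
    "monotone_map ?N m (f i)" "monotone_map ?N m (f (Suc i))"
    using i by (auto simp: monotone_map_def \<alpha>_def \<beta>_def f_def)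
  define a b where "a = act m ?N \<alpha> y" and "b = act m ?N \<beta> y"
  have le: "a \<le> obj T ?N" "b \<le> obj T ?N"
    unfolding a_def b_def using maps y by (auto intro: act_le)
  have a: "act ?N m (f i) a = y" "act ?N m (f (Suc i)) a = y"
    unfolding a_def using maps y
    by (subst act_act[OF _ _ refl]; auto intro!: act_id simp: f_def \<alpha>_def)+
  have b: "act ?N m (f i) b = vertex m i" "act ?N m (f (Suc i)) b = vertex m (Suc i)"
    unfolding b_def using maps y i
    by (subst act_act[OF _ _ refl]; auto intro!: act_const simp: f_def \<beta>_def)+
  show ?thesis
  proof (cases "a \<le> b")
    case True
    then show ?thesis
      using act_mono[OF maps(3) True] a b le by simp
  next
    case False
    then have "b \<le> a" by simp
    then show ?thesis
      using act_mono[OF maps(4) \<open>b \<le> a\<close>] a b le by simp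
  qed
qed

lemma all_vertices:
  assumes y: "y \<le> obj T m"
  shows "\<exists>i\<le>m. y = vertex m i"
proof -
  \<comment> \<open>The last vertex below y must equal y, since no element lies strictly between
    consecutive vertices.\<close>
  define I where "I = {i. i \<le> m \<and> vertex m i \<le> y}"
  have fin: "finite I" and "I \<noteq> {}"
    using vertex_bounds[OF y] by (auto simp: I_def)
  then have max: "Max I \<in> I"
    by (rule Max_in)
  have "y \<le> vertex m (Max I)"
  proof (cases "Max I = m")
    case True
    then show ?thesis using vertex_bounds[OF y] by simp
  next
    case False
    then have "Max I < m" using max by (simp add: I_def)
    moreover have "Suc (Max I) \<notin> I"
      using Max_ge[OF fin] not_less_eq_eq by blast
    ultimately have "\<not> vertex m (Suc (Max I)) \<le> y"
      by (simp add: I_def)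
    with vertex_gap[OF y \<open>Max I < m\<close>] show ?thesis by simp
  qed
  then show ?thesis
    using max by (auto simp: I_def intro!: exI[of _ "Max I"])
qed

lemma constant_case:
  assumes "vertex 1 0 = vertex 1 1"
  shows "T = C0_functor"
proof -
  have eq: "vertex m i = vertex m 0" if "i \<le> m" for m i
    using vertex_as_act[of 0 i m] that assms by simp
  \<comment> \<open>The least and the greatest element of T[m] are vertices, hence equal.\<close>
  have obj: "obj T m = 0" for m
    using all_vertices[of 0 m] all_vertices[of "obj T m" m] eq by (metis le0 order_refl)
  then have "arr T f = ident 0" for f
    using app_le[of 0 "arr T f"] by (intro smor_eqI) simp_all
  with obj show ?thesis
    by (intro functor_data.equality) (simp_all add: C0_functor_def fun_eq_iff)
qed

lemma identity_case:
  assumes lt: "vertex 1 0 < vertex 1 1"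
  shows "T = Id_functor"
proof -
  have strict: "vertex m i < vertex m j" if "i < j" "j \<le> m" for m i j
  proof (rule ccontr)
    \<comment> \<open>This map to [1] separates i from j, so a failure of strictness would be
      carried to T[1].\<close>
    let ?\<chi> = "\<lambda>k. if k < j then 0 else 1 :: nat"
    assume "\<not> vertex m i < vertex m j"
    moreover have \<chi>: "monotone_map m 1 ?\<chi>"
      by (auto simp: monotone_map_def)
    ultimately have "act m 1 ?\<chi> (vertex m j) \<le> act m 1 ?\<chi> (vertex m i)"
      using that by (intro act_mono vertex_le) simp_all
    with lt that act_vertex[OF \<chi>, of i] act_vertex[OF \<chi>, of j] show False
      by simp
  qed
  have obj: "obj T m = m" for m
  proof -
    have "inj_on (vertex m) {..m}"
      using strict by (force intro!: linorder_inj_onI)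
    moreover have "vertex m ` {..m} = {..obj T m}"
      using all_vertices vertex_le by (auto simp: image_iff)
    ultimately have "card {..m} = card {..obj T m}"
      by (metis card_image)
    then show ?thesis by simp
  qed
  \<comment> \<open>A strictly increasing self-map of {0,...,m} is the identity: induction upwards
    from 0 gives one bound, downwards from m the other.\<close>
  have "vertex m i = i" if "i \<le> m" for m i
  proof -
    have "i \<le> vertex m i" if "i \<le> m" for i
      using that
    proof (induction i)
      case (Suc i)
      then show ?case using strict[of i "Suc i" m] by simp
    qed simp
    moreover have "vertex m (m - d) \<le> m - d" if "d \<le> m" for d
      using that
    proof (induction d)
      case 0
      then show ?case using vertex_le[of m m] obj by simp
    next
      case (Suc d)
      then have "vertex m (m - Suc d) < vertex m (m - d)" by (intro strict) auto
      with Suc.IH[OF Suc_leD[OF Suc.prems]] show ?case by linarith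
    qed
    from this[of "m - i"] have "vertex m i \<le> i" using that by simp
    ultimately show ?thesis using that by (simp add: antisym)
  qed
  \<comment> \<open>With the i-th vertex equal to i, naturality of vertices reads T f = f.\<close>
  then have "app (arr T f) k = app f k" if "k \<le> source f" for f k
    using act_vertex[OF monotone_map_app that] that app_le[OF that] by (simp add: act_app)
  then have "arr T f = f" for f
    by (intro smor_eqI) (simp_all add: obj)
  with obj show ?thesis
    by (intro functor_data.equality) (simp_all add: Id_functor_def fun_eq_iff)
qed

lemma constant_or_identity: "T = C0_functor \<or> T = Id_functor"
  using constant_case identity_case vertex_01 by linarith

end

section \<open>Classification of the endofunctors fixing [0]\<close>

context pointed_endofunctor
begin

lemma basis_functor: "T \<in> {Id_functor, C0_functor, Op_functor}"
proof (cases "vertex 1 0 \<le> vertex 1 1")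
  case True
  then interpret increasing_endofunctor T
    by unfold_locales
  show ?thesis
    using constant_or_identity by blast
next
  case False
  \<comment> \<open>Composing \<open>T\<close> with \<open>Op\<close> reverses the order of the
    vertices. Their order in T[1] was strictly decreasing, so \<open>S\<close> cannot be
    constant.\<close>
  define S where "S = \<lparr>obj = obj T, arr = \<lambda>f. op_mor (arr T f)\<rparr>"
  interpret S: pointed_endofunctor S
    by unfold_locales
      (simp_all add: S_def endofunctor_def op_mor_simps arr_ident arr_comp op_mor_ident op_mor_comp
        obj_0)
  have vertex_S: "S.vertex m i = obj T m - vertex m i" if "i \<le> m" for m i
  proof -
    have "S.vertex m i = app (op_mor (arr T (mor 0 m (\<lambda>_. i)))) 0"
      unfolding S.vertex_def S.act_def by (simp add: S_def)
    then show ?thesis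
      using that by (simp add: vertex_def act_def app_op_mor obj_0 monotone_map_def)
  qed
  interpret S: increasing_endofunctor S
    using False by unfold_locales (simp add: vertex_S)
  have "S.vertex 1 0 \<noteq> S.vertex 1 1"
    using False vertex_le[of 0 1] vertex_le[of 1 1] by (simp add: vertex_S)
  then have S: "S = Id_functor"
    using S.identity_case S.vertex_01 by linarith
  have "arr T f = op_mor f" for f
    using arg_cong[OF S, of "\<lambda>S. op_mor (arr S f)"]
    by (simp add: S_def Id_functor_def op_mor_op_mor)
  moreover have "obj T n = n" for n
    using arg_cong[OF S, of "\<lambda>S. obj S n"] by (simp add: S_def Id_functor_def)
  ultimately have "T = Op_functor"
    by (intro functor_data.equality) (simp_all add: Op_functor_def fun_eq_iff)
  then show ?thesis by simp
qed

end

section \<open>Splitting off the last summand\<close>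

context simplex_endofunctor
begin

text \<open>\<open>R\<close> is the fibre over the last point of T[0], \<open>S\<close> the part
  over all earlier points. Removing the last summand fits the left bracketing of
  \<open>functor_sum\<close>.\<close>

lemma split_last:
  assumes obj_0: "obj T 0 = Suc n"
  obtains S R where "endofunctor S" "obj S 0 = n" "endofunctor R" "obj R 0 = 0"
    "T = S \<oplus>\<^sub>\<Delta> R"
proof -
  define p where "p m = act m 0 (\<lambda>_. 0)" for m
  have p_le: "p m y \<le> Suc n" if "y \<le> obj T m" for m y
    unfolding p_def obj_0[symmetric] by (intro act_le that) (simp add: monotone_map_def)
  have p_mono: "p m x \<le> p m y" if "x \<le> y" "y \<le> obj T m" for m x y
    unfolding p_def by (intro act_mono that) (simp add: monotone_map_def)
  have p_act: "p m (act k m f y) = p k y" if "monotone_map k m f" "y \<le> obj T k" for k m f y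
    unfolding p_def by (intro act_act that) (simp_all add: monotone_map_def)
  have p_0: "p 0 y = y" if "y \<le> Suc n" for y
    unfolding p_def using that by (intro act_id) (simp_all add: obj_0)
  \<comment> \<open>Any map [0] to [m] is a section of [m] to [0], and \<open>T\<close> preserves
    sections.\<close>
  have p_surj: "\<exists>y\<le>obj T m. p m y = x" if "x \<le> Suc n" for m x
    using p_act[of 0 m "\<lambda>_. 0" x] act_le[of 0 m "\<lambda>_. 0" x] that p_0[OF that]
    by (auto simp: obj_0 monotone_map_def)

  \<comment> \<open>The last element of T[m] lying over {0,...,n}: the place of the cut.\<close>
  define c where "c m = Max {y. y \<le> obj T m \<and> p m y \<le> n}" for m
  have c_in: "c m \<le> obj T m" "p m (c m) \<le> n" for m
  proof -
    have "{y. y \<le> obj T m \<and> p m y \<le> n} \<noteq> {}"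
      using p_surj[of n m] by auto
    then have "c m \<in> {y. y \<le> obj T m \<and> p m y \<le> n}"
      unfolding c_def by (intro Max_in) auto
    then show "c m \<le> obj T m" "p m (c m) \<le> n" by auto
  qed
  have c_iff: "p m y \<le> n \<longleftrightarrow> y \<le> c m" if "y \<le> obj T m" for m y
    using Max_ge[of "{y. y \<le> obj T m \<and> p m y \<le> n}" y] that p_mono[of y "c m" m] c_in[of m]
    by (auto simp: c_def)
  have c_less: "c m < obj T m" for m
    using p_surj[of "Suc n" m] c_iff[of _ m] by fastforce
  have c_0: "c 0 = n"
  proof -
    have "y \<le> n \<longleftrightarrow> y \<le> c 0" if "y \<le> Suc n" for y
      using c_iff[of y 0] p_0[of y] that obj_0 by simp
    from this[of n] this[of "c 0"] show ?thesis
      using c_in(1)[of 0] obj_0 by simp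
  qed
  \<comment> \<open>Naturality of \<open>p\<close>: T f neither leaves nor enters the lower part, so
    it restricts to both parts.\<close>
  have arr_iff: "app (arr T f) y \<le> c (target f) \<longleftrightarrow> y \<le> c (source f)"
    if "y \<le> obj T (source f)" for f y
    using that p_act[OF monotone_map_app that] c_iff[OF that] act_le[OF monotone_map_app that]
    by (simp add: act_app flip: c_iff)
  have arr_le: "app (arr T f) y \<le> obj T (target f)" if "y \<le> obj T (source f)" for f y
    using app_le[of y "arr T f"] that by simp
  have arr_mono: "app (arr T f) x \<le> app (arr T f) y" if "x \<le> y" "y \<le> obj T (source f)" for f x y
    using app_mono[of x y "arr T f"] that by simp

  \<comment> \<open>The object [k] has k + 1 elements, so the upper part, with
    \<open>obj T m - c m\<close> elements, is the object \<open>d m\<close>.\<close>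
  define d where "d m = obj T m - Suc (c m)" for m
  have d: "obj T m = c m + d m + 1" for m
    using c_less[of m] by (simp add: d_def)
  define s where "s f = mor (c (source f)) (c (target f)) (app (arr T f))" for f
  define r where "r f = mor (d (source f)) (d (target f))
    (\<lambda>k. app (arr T f) (c (source f) + 1 + k) - Suc (c (target f)))" for f
  have s_map: "monotone_map (c (source f)) (c (target f)) (app (arr T f))" for f
    using c_less[of "source f"] by (auto simp: monotone_map_def arr_iff intro!: arr_mono)
  have r_map: "monotone_map (d (source f)) (d (target f))
      (\<lambda>k. app (arr T f) (c (source f) + 1 + k) - Suc (c (target f)))" for f
  proof -
    have "app (arr T f) (c (source f) + 1 + k) \<le> c (target f) + d (target f) + 1"
      if "k \<le> d (source f)" for k
      using arr_le[of "c (source f) + 1 + k" f] that by (simp add: d)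
    then show ?thesis
      by (fastforce simp: monotone_map_def d intro!: diff_le_mono arr_mono)
  qed
  have s: "source (s f) = c (source f)" "target (s f) = c (target f)"
    "k \<le> c (source f) \<Longrightarrow> app (s f) k = app (arr T f) k" for f k
    using s_map[of f] by (simp_all add: s_def)
  \<comment> \<open>By \<open>arr_iff\<close> the upper part is sent above the cut, so the truncated
    subtraction in \<open>r\<close> loses nothing.\<close>
  have r: "source (r f) = d (source f)" "target (r f) = d (target f)"
    "k \<le> d (source f) \<Longrightarrow> c (target f) + 1 + app (r f) k = app (arr T f) (c (source f) + 1 + k)"
    for f k
    using r_map[of f] arr_iff[of "c (source f) + 1 + k" f] d[of "source f"]
    by (simp_all add: r_def)

  have "endofunctor \<lparr>obj = c, arr = s\<rparr>"
    unfolding endofunctor_def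
  proof (simp add: s, intro conjI allI impI)
    show "s (ident m) = ident (c m)" for m
      using d[of m] by (intro smor_eqI) (simp_all add: s arr_ident)
    show "s (g \<circ>\<^sub>\<Delta> f) = s g \<circ>\<^sub>\<Delta> s f" if fg: "target f = source g" for f g
    proof (rule smor_eqI)
      fix k assume "k \<le> source (s (g \<circ>\<^sub>\<Delta> f))"
      then have k: "k \<le> c (source f)" by (simp add: s comp_simps fg)
      then have "k \<le> obj T (source f)" using d[of "source f"] by simp
      with k fg show "app (s (g \<circ>\<^sub>\<Delta> f)) k = app (s g \<circ>\<^sub>\<Delta> s f) k"
        by (simp add: s comp_simps arr_comp arr_iff flip: fg)
    qed (simp_all add: s comp_simps fg)
  qed
  moreover have "endofunctor \<lparr>obj = d, arr = r\<rparr>"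
    unfolding endofunctor_def
  proof (simp add: r, intro conjI allI impI)
    show "r (ident m) = ident (d m)" for m
    proof (rule smor_eqI)
      fix k assume "k \<le> source (r (ident m))"
      then show "app (r (ident m)) k = app (ident (d m)) k"
        using r(3)[of k "ident m"] d[of m] by (simp add: r(1) arr_ident)
    qed (simp_all add: r)
    show "r (g \<circ>\<^sub>\<Delta> f) = r g \<circ>\<^sub>\<Delta> r f" if fg: "target f = source g" for f g
    proof (rule smor_eqI)
      fix k assume "k \<le> source (r (g \<circ>\<^sub>\<Delta> f))"
      then have k: "k \<le> d (source f)" by (simp add: r comp_simps fg)
      then have k': "c (source f) + 1 + k \<le> obj T (source f)" using d[of "source f"] by simp
      have fk: "app (r f) k \<le> d (source g)"
        using app_le[of k "r f"] k fg by (simp add: r)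
      have "c (target g) + 1 + app (r (g \<circ>\<^sub>\<Delta> f)) k = app (arr T (g \<circ>\<^sub>\<Delta> f)) (c (source f) + 1 + k)"
        using r(3)[of k "g \<circ>\<^sub>\<Delta> f"] k by (simp add: comp_simps fg)
      also have "\<dots> = app (arr T g) (c (source g) + 1 + app (r f) k)"
        using r(3)[OF k] k' fg by (simp add: arr_comp app_comp)
      also have "\<dots> = c (target g) + 1 + app (r g) (app (r f) k)"
        using r(3)[OF fk] by simp
      finally show "app (r (g \<circ>\<^sub>\<Delta> f)) k = app (r g \<circ>\<^sub>\<Delta> r f) k"
        using k fg by (simp add: comp_simps r(1,2))
    qed (simp_all add: r comp_simps fg)
  qed
  moreover have "arr T f = concat_mor (s f) (r f)" for f
  proof (rule smor_eqI)
    fix k assume "k \<le> source (arr T f)"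
    then show "app (arr T f) k = app (concat_mor (s f) (r f)) k"
      using r(3)[of "k - c (source f) - 1" f]
      by (auto simp: app_concat_mor s r(1,2) d)
  qed (simp_all add: concat_mor_simps s r d)
  then have "T = \<lparr>obj = c, arr = s\<rparr> \<oplus>\<^sub>\<Delta> \<lparr>obj = d, arr = r\<rparr>"
    by (intro functor_data.equality) (simp_all add: functor_add_def concat_obj_def d fun_eq_iff)
  moreover have "d 0 = 0"
    using d[of 0] by (simp add: c_0 obj_0)
  ultimately show thesis
    using c_0 that by force
qed

end

section \<open>Induction on the number of summands\<close>

lemma functor_sum_cong: "(\<And>i. i \<le> n \<Longrightarrow> B i = B' i) \<Longrightarrow> functor_sum B n = functor_sum B' n"
  by (induction n) auto

theorem theorem3p12:
  fixes T :: functor_data and n :: nat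
  assumes "endofunctor T"
    and "obj T 0 = n"
  shows "\<exists>B :: nat \<Rightarrow> functor_data.
           (\<forall>i\<le>n. B i \<in> {Id_functor, C0_functor, Op_functor}) \<and> T = functor_sum B n"
  using assms
proof (induction n arbitrary: T)
  case 0
  then interpret pointed_endofunctor T
    by unfold_locales
  show ?case
    using basis_functor by (intro exI[of _ "\<lambda>_. T"]) simp
next
  case (Suc n)
  from Suc.prems(1) interpret simplex_endofunctor T
    by unfold_locales
  obtain S R where S: "endofunctor S" "obj S 0 = n" and R: "endofunctor R" "obj R 0 = 0"
    and T: "T = S \<oplus>\<^sub>\<Delta> R"
    using split_last[OF Suc.prems(2)] .
  from R interpret R: pointed_endofunctor R
    by unfold_locales
  obtain B where B: "\<forall>i\<le>n. B i \<in> {Id_functor, C0_functor, Op_functor}" "S = functor_sum B n"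
    using Suc.IH[OF S] by blast
  have "functor_sum (B(Suc n := R)) n = functor_sum B n"
    by (rule functor_sum_cong) simp
  then have "T = functor_sum (B(Suc n := R)) (Suc n)"
    by (simp add: T B(2))
  moreover have "\<forall>i\<le>Suc n. (B(Suc n := R)) i \<in> {Id_functor, C0_functor, Op_functor}"
    using B(1) R.basis_functor by (simp add: le_Suc_eq)
  ultimately show ?case by blast
qed

end
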